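(* For every $s,t \in \mathbb{N}$ and every fixed $p \in (0,1)$ there is a constant $C'>0$ such that, with probability tending to $1$ as $n\to\infty$, \[ \operatorname{ex}_I(G(n,p),K_{s,t}) \le C' n^{2-1/s}(\log n)^{1/s}. \]
   Context: $G(n,p)$ denotes the Erdős–Rényi random graph on vertex set $[n]$ in which each pair of vertices is an edge independently with probability $p$. For graphs $G$ and $L$, $\operatorname{ex}_I(G,L)$ denotes the maximum number of edges of a subgraph of $G$ that contains no induced copy of $L$. $K_{s,t}$ is the complete bipartite graph with parts of sizes $s$ and $t$. *)

theory Defs
  imports "HOL-Probability.Probability"
begin

text \<open>Finite simple undirected graphs: every edge is a two-element set of vertices.\<close>

record 'a ugraph =
  verts :: "'a set"
  edges :: "'a set set"

definition pairs :: "'a set \<Rightarrow> 'a set set" where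
  "pairs V = {e. e \<subseteq> V \<and> card e = 2}"

definition simple_graph :: "'a ugraph \<Rightarrow> bool" where
  "simple_graph G \<longleftrightarrow> finite (verts G) \<and> edges G \<subseteq> pairs (verts G)"

definition subgraph_of :: "'a ugraph \<Rightarrow> 'a ugraph \<Rightarrow> bool" where
  "subgraph_of H G \<longleftrightarrow> simple_graph H \<and> verts H \<subseteq> verts G \<and> edges H \<subseteq> edges G"

definition induced_on :: "'a ugraph \<Rightarrow> 'a set \<Rightarrow> 'a ugraph" where
  "induced_on G W = \<lparr>verts = W, edges = {e \<in> edges G. e \<subseteq> W}\<rparr>"

definition graph_iso :: "'a ugraph \<Rightarrow> 'b ugraph \<Rightarrow> bool" where
  "graph_iso G L \<longleftrightarrow> (\<exists>f. bij_betw f (verts G) (verts L) \<and>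
     (\<forall>u\<in>verts G. \<forall>v\<in>verts G. {u, v} \<in> edges G \<longleftrightarrow> {f u, f v} \<in> edges L))"

definition has_induced_copy :: "'a ugraph \<Rightarrow> 'b ugraph \<Rightarrow> bool" where
  "has_induced_copy G L \<longleftrightarrow> (\<exists>W. W \<subseteq> verts G \<and> graph_iso (induced_on G W) L)"

text \<open>The subgraph \<open>H\<close> ranges over all subgraphs of \<open>G\<close>, not just the induced ones;
  ``induced copy'' refers to \<open>H\<close> itself.\<close>

definition ex_ind :: "'a ugraph \<Rightarrow> 'b ugraph \<Rightarrow> nat" where
  "ex_ind G L = Max {card (edges H) | H. subgraph_of H G \<and> \<not> has_induced_copy H L}"

definition complete_bipartite :: "nat \<Rightarrow> nat \<Rightarrow> (nat + nat) ugraph" where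
  "complete_bipartite s t =
     \<lparr>verts = Inl ` {1..s} \<union> Inr ` {1..t},
      edges = {{Inl i, Inr j} | i j. i \<in> {1..s} \<and> j \<in> {1..t}}\<rparr>"

definition gnp :: "nat \<Rightarrow> real \<Rightarrow> nat ugraph pmf" where
  "gnp n p = map_pmf (\<lambda>\<omega>. \<lparr>verts = {1..n}, edges = {e \<in> pairs {1..n}. \<omega> e}\<rparr>)
     (Pi_pmf (pairs {1..n}) False (\<lambda>_. bernoulli_pmf p))"

text \<open>The maximum in \<open>ex_ind\<close> is over a finite set, and for complete bipartite graphs with
  nonempty parts that set is nonempty (it contains the edgeless subgraph).\<close>

lemma finite_pairs: "finite V \<Longrightarrow> finite (pairs V)"
  by (rule finite_subset[of _ "Pow V"]) (auto simp: pairs_def)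

lemma ex_ind_finite:
  assumes "simple_graph G"
  shows "finite {card (edges H) | H. subgraph_of H G \<and> \<not> has_induced_copy H L}"
proof -
  have fin: "finite (edges G)"
    using assms finite_subset[OF _ finite_pairs] unfolding simple_graph_def by blast
  have "card (edges H) \<le> card (edges G)" if "subgraph_of H G" for H
    using that card_mono[OF fin] unfolding subgraph_of_def by simp
  then have "{card (edges H) | H. subgraph_of H G \<and> \<not> has_induced_copy H L}
               \<subseteq> {..card (edges G)}"
    by blast
  then show ?thesis
    by (rule finite_subset) simp
qed

lemma ex_ind_nonempty:
  fixes G :: "'a ugraph"
  assumes "simple_graph G" "s \<ge> 1" "t \<ge> 1"
  shows "0 \<in> {card (edges H) | H. subgraph_of H G \<and> \<not> has_induced_copy H (complete_bipartite s t)}"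
proof -
  define H where "H = \<lparr>verts = verts G, edges = {}\<rparr>"
  have "\<not> has_induced_copy H (complete_bipartite s t)"
  proof
    assume "has_induced_copy H (complete_bipartite s t)"
    then obtain W :: "'a set" and f where f: "bij_betw f W (verts (complete_bipartite s t))"
      and e: "\<forall>u\<in>W. \<forall>v\<in>W. {f u, f v} \<notin> edges (complete_bipartite s t)"
      by (auto simp: has_induced_copy_def graph_iso_def induced_on_def H_def)
    have "Inl 1 \<in> f ` W" "Inr 1 \<in> f ` W"
      using assms f by (simp_all add: complete_bipartite_def bij_betw_def)
    then obtain u w where uw: "u \<in> W" "w \<in> W" "f u = Inl 1" "f w = Inr 1"
      by force
    have "{Inl 1, Inr 1} \<in> edges (complete_bipartite s t)"
      using assms by (fastforce simp: complete_bipartite_def)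
    then show False using e uw by force
  qed
  moreover have "subgraph_of H G" "card (edges H) = 0"
    using assms by (auto simp: subgraph_of_def simple_graph_def H_def)
  ultimately show ?thesis by (intro CollectI exI[of _ H]) simp
qed

end

theory Submission
  imports Defs "HOL-Real_Asymp.Real_Asymp"
begin

text \<open>
  Put \<open>q = 1 - p\<close> and let \<open>R\<close> be of order \<open>log n\<close>. By Hoeffding's inequality and a union bound,
  with high probability any two disjoint vertex sets \<open>A\<close>, \<open>B\<close> of \<open>G = G(n,p)\<close> with \<open>|B| \<ge> |A| = R\<close>
  span at least \<open>(q/2) |A| |B|\<close> non-edges. Choosing vertices greedily, every vertex set \<open>U\<close> with
  \<open>|U| \<ge> C log n\<close> then contains at least \<open>c |U|^k\<close> ordered independent \<open>k\<close>-tuples of \<open>G\<close>. Run the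
  Kovari-Sos-Turan double count on a subgraph \<open>H\<close> without induced \<open>K_{s,t}\<close>, counting only those
  \<open>s\<close>-tuples in \<open>H\<close>-neighbourhoods that are independent in \<open>G\<close>: a constant proportion of all
  tuples survives, and each has fewer than \<open>C log n\<close> common \<open>H\<close>-neighbours, as otherwise these would
  contain a \<open>G\<close>-independent \<open>t\<close>-set and hence complete an induced \<open>K_{s,t}\<close> in \<open>H\<close>.
\<close>

section \<open>Supersaturation of independent tuples\<close>

definition nonnbrs :: "'a ugraph \<Rightarrow> 'a set \<Rightarrow> 'a \<Rightarrow> 'a set" where
  "nonnbrs G U v = {y \<in> U. y \<noteq> v \<and> {v, y} \<notin> edges G}"

text \<open>Quantifying over all large \<open>U\<close> makes the property pass to
  non-neighbourhoods, so that vertices can be chosen one after another.\<close>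

definition co_rich :: "'a ugraph \<Rightarrow> real \<Rightarrow> real \<Rightarrow> bool" where
  "co_rich G \<delta> r \<longleftrightarrow> (\<forall>U \<subseteq> verts G. r \<le> real (card U) \<longrightarrow>
     real (card U) / 2 \<le> real (card {v \<in> U. \<delta> * real (card U) \<le> real (card (nonnbrs G U v))}))"

text \<open>Lists instead of sets: adding a vertex is an injective \<open>Cons\<close>, and no
  factorials enter the counts.\<close>

definition indep_lists :: "'a ugraph \<Rightarrow> 'a set \<Rightarrow> nat \<Rightarrow> 'a list set" where
  "indep_lists G U k = {xs. length xs = k \<and> set xs \<subseteq> U \<and> distinct xs \<and>
     (\<forall>x\<in>set xs. \<forall>y\<in>set xs. {x, y} \<notin> edges G)}"

definition nbrs :: "'a ugraph \<Rightarrow> 'a \<Rightarrow> 'a set" where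
  "nbrs H v = {u. {u, v} \<in> edges H}"

lemma finite_indep_lists: "finite U \<Longrightarrow> finite (indep_lists G U k)"
  by (rule finite_subset[OF _ finite_lists_length_eq[of U k]]) (auto simp: indep_lists_def)

lemma card_indep_lists_le:
  assumes "finite U" shows "card (indep_lists G U k) \<le> card U ^ k"
proof -
  have "card (indep_lists G U k) \<le> card {xs. set xs \<subseteq> U \<and> length xs = k}"
    by (rule card_mono) (use assms in \<open>auto simp: indep_lists_def finite_lists_length_eq\<close>)
  then show ?thesis by (simp add: card_lists_length_eq assms)
qed

lemma simple_graph_no_loop: "simple_graph G \<Longrightarrow> {x, x} \<notin> edges G"
  by (auto simp: simple_graph_def pairs_def)

lemma card_indep_lists_Suc:
  assumes "simple_graph G" "finite U" "X \<subseteq> U"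
  shows "(\<Sum>v\<in>X. card (indep_lists G (nonnbrs G U v) k)) \<le> card (indep_lists G U (Suc k))"
proof -
  let ?I = "\<lambda>v. indep_lists G (nonnbrs G U v) k"
  have fin: "finite (?I v)" for v
    using assms(2) by (intro finite_indep_lists) (simp add: nonnbrs_def)
  have "(\<Sum>v\<in>X. card (?I v)) = card (SIGMA v:X. ?I v)"
    using finite_subset[OF assms(3,2)] fin by simp
  also have "\<dots> = card ((\<lambda>(v, xs). v # xs) ` (SIGMA v:X. ?I v))"
    by (rule card_image[symmetric]) (auto simp: inj_on_def)
  also have "\<dots> \<le> card (indep_lists G U (Suc k))"
  proof (rule card_mono[OF finite_indep_lists[OF assms(2)]])
    show "(\<lambda>(v, xs). v # xs) ` (SIGMA v:X. ?I v) \<subseteq> indep_lists G U (Suc k)"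
      using assms(3) simple_graph_no_loop[OF assms(1)]
      by (fastforce simp: indep_lists_def nonnbrs_def insert_commute)
  qed
  finally show ?thesis .
qed

text \<open>Greedy choice: at least half of \<open>U\<close> may come first, and the rest of the
  list is taken from the non-neighbourhood of that vertex, which keeps a proportion \<delta> of
  \<open>U\<close>. Using the final size \<delta>^k |U| for every position, instead of the actual
  size, gives a bound that reproduces itself in the induction.\<close>

lemma co_rich_many_indep_lists:
  assumes "simple_graph G" "co_rich G \<delta> r" "0 < \<delta>" "\<delta> \<le> 1"
    and "U \<subseteq> verts G" "r \<le> \<delta> ^ k * real (card U)"
  shows "(\<delta> ^ k * real (card U) / 2) ^ k \<le> real (card (indep_lists G U k))"
  using assms(5,6)
proof (induction k arbitrary: U)
  case 0
  have "indep_lists G U 0 = {[]}" by (auto simp: indep_lists_def)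
  then show ?case by simp
next
  case (Suc k)
  let ?u = "real (card U)"
  have finU: "finite U" using assms(1) Suc.prems(1) finite_subset by (auto simp: simple_graph_def)
  define X where "X = {v \<in> U. \<delta> * ?u \<le> real (card (nonnbrs G U v))}"
  have "\<delta> ^ Suc k * ?u \<le> 1 * ?u"
    using assms(3,4) by (intro mult_right_mono power_le_one) auto
  then have "r \<le> ?u" using Suc.prems by simp
  then have X: "?u / 2 \<le> real (card X)"
    using assms(2) Suc.prems(1) unfolding co_rich_def X_def by blast
  have step: "(\<delta> ^ Suc k * ?u / 2) ^ k \<le> real (card (indep_lists G (nonnbrs G U v) k))"
    if "v \<in> X" for v
  proof -
    let ?w = "real (card (nonnbrs G U v))"
    \<comment> \<open>\<delta> to the number of vertices still to be chosen, times the size of the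
      current set, never decreases. This carries both the threshold \<open>r\<close> and the base of
      the power to the next step.\<close>
    have le: "\<delta> ^ Suc k * ?u \<le> \<delta> ^ k * ?w"
      using that assms(3) mult_left_mono[of "\<delta> * ?u" ?w "\<delta> ^ k"] by (simp add: X_def ac_simps)
    have "(\<delta> ^ Suc k * ?u / 2) ^ k \<le> (\<delta> ^ k * ?w / 2) ^ k"
      using le assms(3) by (intro power_mono divide_right_mono) auto
    also have "\<dots> \<le> real (card (indep_lists G (nonnbrs G U v) k))"
      using Suc.prems le by (intro Suc.IH) (auto simp: nonnbrs_def)
    finally show ?thesis .
  qed
  have "\<delta> ^ Suc k * ?u / 2 \<le> ?u / 2"
    using \<open>\<delta> ^ Suc k * ?u \<le> 1 * ?u\<close> by simp
  then have "(\<delta> ^ Suc k * ?u / 2) ^ Suc k \<le> real (card X) * (\<delta> ^ Suc k * ?u / 2) ^ k"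
    using X assms(3) by (simp only: power_Suc) (intro mult_right_mono; simp)
  also have "\<dots> \<le> (\<Sum>v\<in>X. real (card (indep_lists G (nonnbrs G U v) k)))"
    using sum_bounded_below[of X "(\<delta> ^ Suc k * ?u / 2) ^ k"] step by simp
  also have "\<dots> \<le> real (card (indep_lists G U (Suc k)))"
    using card_indep_lists_Suc[OF assms(1) finU, of X k]
    by (simp add: X_def flip: of_nat_sum)
  finally show ?case .
qed

section \<open>Kovari-Sos-Turan count for induced copies\<close>

lemma induced_complete_bipartite:
  assumes H: "simple_graph H" "S \<subseteq> verts H" "T \<subseteq> verts H"
    and c: "finite S" "finite T" "card S = s" "card T = t"
    and S: "\<And>x y. x \<in> S \<Longrightarrow> y \<in> S \<Longrightarrow> {x, y} \<notin> edges H"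
    and T: "\<And>x y. x \<in> T \<Longrightarrow> y \<in> T \<Longrightarrow> {x, y} \<notin> edges H"
    and ST: "\<And>x y. x \<in> S \<Longrightarrow> y \<in> T \<Longrightarrow> {x, y} \<in> edges H"
  shows "has_induced_copy H (complete_bipartite s t)"
proof -
  \<comment> \<open>A common element \<open>x\<close> would make \<open>{x, x}\<close> an edge by
    \<open>ST\<close> and a non-edge by \<open>S\<close>.\<close>
  have disj: "S \<inter> T = {}" using S ST by blast
  obtain g where g: "bij_betw g S {1..s}"
    using finite_same_card_bij[of S "{1..s}"] c by auto
  obtain h where h: "bij_betw h T {1..t}"
    using finite_same_card_bij[of T "{1..t}"] c by auto
  define f where "f u = (if u \<in> S then Inl (g u) else Inr (h u))" for u
  have "bij_betw f S (Inl ` {1..s})"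
    using g by (auto simp: f_def bij_betw_def inj_on_def)
  moreover have "bij_betw f T (Inr ` {1..t})"
  proof -
    have "f u = Inr (h u)" if "u \<in> T" for u using that disj by (auto simp: f_def)
    then show ?thesis using h by (auto simp: bij_betw_def inj_on_def image_iff)
  qed
  ultimately have bij: "bij_betw f (S \<union> T) (verts (complete_bipartite s t))"
    unfolding complete_bipartite_def by (auto intro: bij_betw_combine)
  \<comment> \<open>As \<open>S\<close> and \<open>T\<close> are disjoint, the right-hand side says
    that \<open>u\<close> and \<open>v\<close> lie on different sides.\<close>
  have edge: "{f u, f v} \<in> edges (complete_bipartite s t) \<longleftrightarrow> (u \<in> S \<longleftrightarrow> v \<in> T)"
    if "u \<in> S \<union> T" "v \<in> S \<union> T" for u v
    using that disj bij_betwE[OF g] bij_betwE[OF h]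
    by (auto simp: complete_bipartite_def f_def doubleton_eq_iff)
  have "{u, v} \<in> edges H \<longleftrightarrow> (u \<in> S \<longleftrightarrow> v \<in> T)" if "u \<in> S \<union> T" "v \<in> S \<union> T" for u v
    using that disj S T ST ST[of v u] by (auto simp: insert_commute)
  then have "graph_iso (induced_on H (S \<union> T)) (complete_bipartite s t)"
    using bij edge unfolding graph_iso_def induced_on_def by (intro exI[of _ f]) auto
  then show ?thesis unfolding has_induced_copy_def using H by blast
qed

text \<open>Every edge arises from an ordered pair of adjacent vertices. The factor two lost against
  the handshake lemma only affects the constant.\<close>

lemma card_edges_le_sum_nbrs:
  assumes "simple_graph H"
  shows "card (edges H) \<le> (\<Sum>v\<in>verts H. card (nbrs H v))"
proof -
  have sub: "nbrs H v \<subseteq> verts H" for v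
    using assms by (auto simp: nbrs_def simple_graph_def pairs_def)
  have fin: "finite (verts H)" using assms by (simp add: simple_graph_def)
  have "edges H \<subseteq> (\<lambda>(v, u). {u, v}) ` (SIGMA v:verts H. nbrs H v)"
  proof
    fix e assume e: "e \<in> edges H"
    then have "e \<subseteq> verts H" "card e = 2"
      using assms by (auto simp: simple_graph_def pairs_def)
    moreover obtain u v where "e = {u, v}"
      using \<open>card e = 2\<close> unfolding card_2_iff by blast
    ultimately have "e = {u, v}" "v \<in> verts H" by auto
    then show "e \<in> (\<lambda>(v, u). {u, v}) ` (SIGMA v:verts H. nbrs H v)"
      using e by (auto simp: nbrs_def image_iff)
  qed
  then have "card (edges H) \<le> card (SIGMA v:verts H. nbrs H v)"
    using fin finite_subset[OF sub fin] by (intro surj_card_le) auto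
  then show ?thesis using fin finite_subset[OF sub fin] by simp
qed

text \<open>With \<open>D\<close> half the average degree, this stands in for Jensen's inequality, and it is vacuous for
  exactly those degrees \<open>d \<le> D\<close> that may be too small for the supersaturation bound.\<close>

lemma power_ge_shifted_linear:
  fixes d D :: real
  assumes "0 \<le> d" "0 \<le> D" "s \<ge> 1"
  shows "D ^ (s - 1) * (d - D) \<le> d ^ s"
proof (cases "D \<le> d")
  case True
  have "D ^ (s - 1) * (d - D) \<le> d ^ (s - 1) * d"
    using True assms by (intro mult_mono power_mono) auto
  also have "\<dots> = d ^ s" using assms(3) by (simp flip: power_Suc2)
  finally show ?thesis .
next
  case False
  then have "D ^ (s - 1) * (d - D) \<le> 0" using assms by (intro mult_nonneg_nonpos) auto
  then show ?thesis using assms(1) by (meson order_trans zero_le_power)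
qed

text \<open>Counts pairs of a vertex \<open>v\<close> of \<open>H\<close> and a
  \<open>G\<close>-independent \<open>s\<close>-list inside \<open>nbrs H v\<close>: supersaturation
  bounds them from below for each \<open>v\<close>, the missing induced copy bounds them from above
  for each list.\<close>

lemma co_rich_induced_kst:
  fixes G H :: "'a ugraph"
  assumes G: "simple_graph G" "co_rich G \<delta> r" "0 < \<delta>" "\<delta> \<le> 1" "0 < r"
    and H: "subgraph_of H G" "\<not> has_induced_copy H (complete_bipartite s t)"
    and st: "s \<ge> 1" "s \<le> k" "t \<le> k"
    and D: "D = real (card (edges H)) / (2 * real (card (verts G)))" "r / \<delta> ^ k \<le> D"
  shows "(\<delta> ^ k / 2) ^ s * (real (card (verts G)) * D ^ s)
           \<le> real (card (verts G)) ^ s * (r / \<delta> ^ k)"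
proof -
  define n where "n = real (card (verts G))"
  \<comment> \<open>The set size from which supersaturation applies for up to \<open>k\<close>
    vertices.\<close>
  define M where "M = r / \<delta> ^ k"
  define c where "c = (\<delta> ^ k / 2) ^ s"
  define d where "d v = real (card (nbrs H v))" for v
  have Mpos: "M > 0" and cpos: "c > 0" using G by (auto simp: M_def c_def)
  have VH: "verts H \<subseteq> verts G" and EH: "edges H \<subseteq> edges G" and sH: "simple_graph H"
    using H(1) by (auto simp: subgraph_of_def)
  have finG: "finite (verts G)" and finH: "finite (verts H)"
    using G(1) sH by (auto simp: simple_graph_def)
  have Npos: "n > 0"
  proof (rule ccontr)
    assume "\<not> n > 0"
    then have "D = 0" by (simp add: n_def D)
    then show False using D(2) Mpos by (simp add: M_def)
  qed
  have nbr: "nbrs H v \<subseteq> verts H" for v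
    using sH by (auto simp: nbrs_def simple_graph_def pairs_def)
  \<comment> \<open>Weakening \<delta>^j to \<delta>^k gives one threshold and one base for both
    uses, \<open>j = s\<close> in neighbourhoods and \<open>j = t\<close> in common
    neighbourhoods.\<close>
  have many: "(\<delta> ^ k * real (card U) / 2) ^ j \<le> real (card (indep_lists G U j))"
    if "U \<subseteq> verts G" "M \<le> real (card U)" "j \<le> k" for U j
  proof -
    have le: "\<delta> ^ k * real (card U) \<le> \<delta> ^ j * real (card U)"
      using G that by (intro mult_right_mono power_decreasing) auto
    have "r \<le> \<delta> ^ k * real (card U)"
      using that(2) G(3) by (simp add: M_def field_simps)
    then have "(\<delta> ^ j * real (card U) / 2) ^ j \<le> real (card (indep_lists G U j))"
      using le that by (intro co_rich_many_indep_lists[OF G(1-4)]) auto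
    moreover have "(\<delta> ^ k * real (card U) / 2) ^ j \<le> (\<delta> ^ j * real (card U) / 2) ^ j"
      using le G(3) by (intro power_mono divide_right_mono) auto
    ultimately show ?thesis by linarith
  qed
  have lower: "c * (D ^ (s - 1) * (d v - D)) \<le> real (card (indep_lists G (nbrs H v) s))"
    for v
  proof (cases "D \<le> d v")
    case True
    have "D ^ (s - 1) * (d v - D) \<le> d v ^ s"
      using D(2) Mpos by (intro power_ge_shifted_linear st) (auto simp: d_def M_def)
    then have "c * (D ^ (s - 1) * (d v - D)) \<le> c * d v ^ s"
      using cpos by simp
    also have "\<dots> = (\<delta> ^ k * d v / 2) ^ s"
      by (simp add: c_def flip: power_mult_distrib)
    also have "\<dots> \<le> real (card (indep_lists G (nbrs H v) s))"
      unfolding d_def using True D(2) nbr VH st by (intro many) (auto simp: M_def d_def)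
    finally show ?thesis .
  next
    case False
    then have "c * (D ^ (s - 1) * (d v - D)) \<le> 0"
      using cpos Mpos D(2) by (intro mult_nonneg_nonpos) (auto simp: M_def)
    then show ?thesis by (meson of_nat_0_le_iff order_trans)
  qed
  have upper: "real (card {v \<in> verts H. set xs \<subseteq> nbrs H v}) \<le> M"
    if xs: "xs \<in> indep_lists G (verts G) s" for xs
  proof (rule ccontr)
    define T where "T = {v \<in> verts H. set xs \<subseteq> nbrs H v}"
    assume "\<not> real (card {v \<in> verts H. set xs \<subseteq> nbrs H v}) \<le> M"
    then have T: "M < real (card T)" by (simp add: T_def)
    have "(\<delta> ^ k * real (card T) / 2) ^ t \<le> real (card (indep_lists G T t))"
      using T VH st by (intro many) (auto simp: T_def)
    moreover have "(\<delta> ^ k * real (card T) / 2) ^ t > 0"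
      using T Mpos G(3) by (intro zero_less_power) auto
    ultimately have "card (indep_lists G T t) > 0" by linarith
    then obtain ys where ys: "ys \<in> indep_lists G T t" by fastforce
    \<comment> \<open>The list \<open>xs\<close> comes from \<open>verts G\<close>; only a common
      \<open>H\<close>-neighbour shows that its entries are vertices of \<open>H\<close>.\<close>
    obtain v where "v \<in> T" using T Mpos by fastforce
    then have "set xs \<subseteq> verts H" using nbr by (auto simp: T_def)
    then have "has_induced_copy H (complete_bipartite s t)"
      using xs ys EH
      by (intro induced_complete_bipartite[OF sH, of "set xs" "set ys"])
         (auto simp: indep_lists_def T_def nbrs_def distinct_card)
    then show False using H(2) by simp
  qed
  let ?L = "indep_lists G (verts G) s"
  have finL: "finite ?L" by (rule finite_indep_lists[OF finG])
  \<comment> \<open>\<open>D\<close> is half of m/n, where m counts the edges of \<open>H\<close>.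
    The degrees sum to at least m = 2nD, so lowering each of them by \<open>D\<close> still leaves
    nD.\<close>
  have "n * D = real (card (edges H)) - n * D"
    using Npos by (simp add: D n_def)
  also have "\<dots> \<le> (\<Sum>v\<in>verts H. d v) - (\<Sum>v\<in>verts H. D)"
  proof -
    have "real (card (edges H)) \<le> (\<Sum>v\<in>verts H. d v)"
      using card_edges_le_sum_nbrs[OF sH] by (simp add: d_def flip: of_nat_sum)
    moreover have "real (card (verts H)) * D \<le> n * D"
      using card_mono[OF finG VH] D(2) Mpos by (intro mult_right_mono) (auto simp: n_def M_def)
    ultimately show ?thesis by simp
  qed
  also have "\<dots> = (\<Sum>v\<in>verts H. d v - D)" by (simp add: sum_subtractf)
  finally have "c * (D ^ (s - 1) * (n * D)) \<le> c * (D ^ (s - 1) * (\<Sum>v\<in>verts H. d v - D))"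
    using cpos D(2) Mpos by (intro mult_left_mono) (auto simp: M_def)
  also have "\<dots> = (\<Sum>v\<in>verts H. c * (D ^ (s - 1) * (d v - D)))"
    by (simp add: sum_distrib_left)
  also have "\<dots> \<le> (\<Sum>v\<in>verts H. real (card (indep_lists G (nbrs H v) s)))"
    by (intro sum_mono lower)
  also have "\<dots> = (\<Sum>v\<in>verts H. real (card {xs \<in> ?L. set xs \<subseteq> nbrs H v}))"
  proof -
    have "indep_lists G (nbrs H v) s = {xs \<in> ?L. set xs \<subseteq> nbrs H v}" for v
      using nbr VH by (fastforce simp: indep_lists_def)
    then show ?thesis by simp
  qed
  also have "\<dots> = (\<Sum>xs\<in>?L. real (card {v \<in> verts H. set xs \<subseteq> nbrs H v}))"
    using sum_multicount_gen[OF finH finL, of "\<lambda>v xs. set xs \<subseteq> nbrs H v"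
        "\<lambda>xs. card {v \<in> verts H. set xs \<subseteq> nbrs H v}"]
    by (simp flip: of_nat_sum)
  also have "\<dots> \<le> (\<Sum>xs\<in>?L. M)" by (intro sum_mono upper)
  also have "\<dots> = real (card ?L) * M" by simp
  also have "\<dots> \<le> n ^ s * M"
    using card_indep_lists_le[OF finG, of G s] Mpos
    by (intro mult_right_mono) (auto simp: n_def simp flip: of_nat_power)
  finally have "c * (n * (D ^ (s - 1) * D)) \<le> n ^ s * M" by (simp add: ac_simps)
  then have "c * (n * D ^ s) \<le> n ^ s * M" using st(1) by (simp flip: power_Suc2)
  then show ?thesis by (simp add: c_def n_def M_def)
qed

section \<open>From bipartite non-edge density to \<open>co_rich\<close>\<close>

definition co_bidense :: "'a ugraph \<Rightarrow> real \<Rightarrow> nat \<Rightarrow> bool" where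
  "co_bidense G \<epsilon> R \<longleftrightarrow> (\<forall>A B. A \<subseteq> verts G \<longrightarrow> B \<subseteq> verts G \<longrightarrow> A \<inter> B = {} \<longrightarrow>
     card A = R \<longrightarrow> R \<le> card B \<longrightarrow>
     \<epsilon> * (real (card A) * real (card B)) \<le> real (\<Sum>a\<in>A. card (nonnbrs G B a)))"

text \<open>If \<open>R\<close> vertices of \<open>U\<close> had too few non-neighbours, they would
  form a set \<open>A\<close> that is too dense towards \<open>B = U - A\<close>. As |U| is at least
  2R, \<open>B\<close> has at least |U|/2 elements, which costs the factor 2 in \<epsilon>/2, and
  the fewer than \<open>R\<close> bad vertices are at most half of \<open>U\<close>. Bad sets can be
  cut down to size \<open>R\<close>, but \<open>B\<close> can be of any larger size; hence the
  asymmetry in \<open>co_bidense\<close>.\<close>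

lemma co_bidense_imp_co_rich:
  assumes "finite (verts G)" "co_bidense G \<epsilon> R" "0 < \<epsilon>" "R \<ge> 1"
  shows "co_rich G (\<epsilon> / 2) (2 * real R)"
  unfolding co_rich_def
proof (intro allI impI)
  fix U assume U: "U \<subseteq> verts G" "2 * real R \<le> real (card U)"
  have finU: "finite U" using U assms(1) finite_subset by blast
  define X where "X = {v \<in> U. \<epsilon> / 2 * real (card U) \<le> real (card (nonnbrs G U v))}"
  have "card (U - X) < R"
  proof (rule ccontr)
    assume "\<not> card (U - X) < R"
    then obtain A where A: "A \<subseteq> U - X" "card A = R" "finite A"
      by (meson not_less obtain_subset_with_card_n)
    have cB: "card (U - A) = card U - R"
      using A by (subst card_Diff_subset) auto
    then have B: "real (card U) / 2 \<le> real (card (U - A))" and RB: "R \<le> card (U - A)"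
      using U(2) by auto
    have "\<epsilon> * (real R * (real (card U) / 2)) \<le> \<epsilon> * (real (card A) * real (card (U - A)))"
      unfolding A(2) using B assms(3) by (intro mult_left_mono) auto
    also have "\<dots> \<le> real (\<Sum>a\<in>A. card (nonnbrs G (U - A) a))"
      using assms(2)[unfolded co_bidense_def, rule_format, of A "U - A"] A U(1) RB by auto
    also have "\<dots> \<le> (\<Sum>a\<in>A. real (card (nonnbrs G U a)))"
      unfolding of_nat_sum using finU
      by (intro sum_mono of_nat_mono card_mono) (auto simp: nonnbrs_def)
    also have "\<dots> < (\<Sum>a\<in>A. \<epsilon> / 2 * real (card U))"
      using A assms(4) by (intro sum_strict_mono) (auto simp: X_def)
    also have "\<dots> = \<epsilon> * (real R * (real (card U) / 2))"
      using A by simp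
    finally show False by simp
  qed
  moreover have "card (U - X) = card U - card X"
    using finU by (intro card_Diff_subset) (auto simp: X_def)
  ultimately have "real (card U) / 2 \<le> real (card X)" using U(2) by linarith
  then show "real (card U) / 2
      \<le> real (card {v \<in> U. \<epsilon> / 2 * real (card U) \<le> real (card (nonnbrs G U v))})"
    by (simp add: X_def)
qed

section \<open>Concentration and union bound in \<open>gnp\<close>\<close>

text \<open>Disjointness makes the |A||B| pairs distinct, so their number of edges is binomial.
  Fewer than half the expected non-edges means exceeding the mean by (1-p)/2 |A||B|, and Hoeffding
  applies.\<close>

lemma prob_few_nonedges_between:
  fixes p :: real
  assumes p: "0 < p" "p < 1"
    and AB: "A \<subseteq> {1..n}" "B \<subseteq> {1..n}" "A \<inter> B = {}" "A \<noteq> {}" "B \<noteq> {}"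
  shows "measure_pmf.prob (gnp n p)
           {G. real (\<Sum>a\<in>A. card (nonnbrs G B a)) < (1 - p) / 2 * (real (card A) * real (card B))}
         \<le> exp (- ((1 - p)\<^sup>2 / 2 * (real (card A) * real (card B))))"
proof -
  let ?e = "\<lambda>(a, b). {a, b} :: nat set"
  define F where "F = ?e ` (A \<times> B)"
  define N where "N = card A * card B"
  let ?P = "Pi_pmf (pairs {1..n}) False (\<lambda>_. bernoulli_pmf p)"
  let ?g = "\<lambda>\<omega>. \<lparr>verts = {1..n}, edges = {e \<in> pairs {1..n}. \<omega> e}\<rparr>"
  have fin: "finite A" "finite B" using AB finite_subset by blast+
  have inj: "inj_on ?e (A \<times> B)"
    using AB(3) by (auto simp: inj_on_def doubleton_eq_iff)
  have cF: "card F = N" by (simp add: F_def N_def card_image[OF inj] card_cartesian_product)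
  have finF: "finite F" using fin by (simp add: F_def)
  have Fp: "F \<subseteq> pairs {1..n}"
  proof -
    have "a \<noteq> b" if "a \<in> A" "b \<in> B" for a b using that AB(3) by blast
    then show ?thesis using AB(1,2) by (auto simp: F_def pairs_def)
  qed
  have Npos: "N > 0" using AB fin by (auto simp: N_def card_gt_0_iff)
  have count: "(\<Sum>a\<in>A. card (nonnbrs (?g \<omega>) B a)) = N - card {e \<in> F. \<omega> e}" for \<omega>
  proof -
    have "(\<Sum>a\<in>A. card (nonnbrs (?g \<omega>) B a)) = card (SIGMA a:A. nonnbrs (?g \<omega>) B a)"
      using fin by (simp add: nonnbrs_def)
    also have "\<dots> = card (?e ` (SIGMA a:A. nonnbrs (?g \<omega>) B a))"
      by (rule card_image[symmetric], rule inj_on_subset[OF inj]) (auto simp: nonnbrs_def)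
    also have "?e ` (SIGMA a:A. nonnbrs (?g \<omega>) B a) = F - {e \<in> F. \<omega> e}"
    proof -
      have pr: "{a, b} \<in> pairs {1..n}" if "a \<in> A" "b \<in> B" for a b
        using that Fp by (auto simp: F_def)
      have "a \<noteq> b" if "a \<in> A" "b \<in> B" for a b using that AB(3) by blast
      then show ?thesis
        using pr by (fastforce simp: F_def nonnbrs_def)
    qed
    also have "card (F - {e \<in> F. \<omega> e}) = N - card {e \<in> F. \<omega> e}"
      using finF cF by (subst card_Diff_subset) auto
    finally show ?thesis .
  qed
  have bin: "binomial_pmf N p = map_pmf (\<lambda>\<omega>. card {e \<in> F. \<omega> e}) ?P"
  proof -
    have "binomial_pmf N p = map_pmf (\<lambda>\<omega>. card {e \<in> F. \<omega> e}) (Pi_pmf F False (\<lambda>_. bernoulli_pmf p))"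
      using finF cF p by (intro binomial_pmf_altdef') auto
    \<comment> \<open>The edge indicators outside \<open>F\<close> are marginalised away.\<close>
    also have "\<dots> = map_pmf (\<lambda>\<omega>. card {e \<in> F. if e \<in> F then \<omega> e else False}) ?P"
      by (subst Pi_pmf_subset[OF finite_pairs Fp]) (auto simp: map_pmf_comp)
    also have "(\<lambda>\<omega>. card {e \<in> F. if e \<in> F then \<omega> e else False}) = (\<lambda>\<omega>. card {e \<in> F. \<omega> e})"
      by (intro ext arg_cong[of _ _ card]) auto
    finally show ?thesis .
  qed
  \<comment> \<open>This makes the truncated subtraction in \<open>count\<close> exact.\<close>
  have cle: "card {e \<in> F. \<omega> e} \<le> N" for \<omega>
    using card_mono[OF finF, of "{e \<in> F. \<omega> e}"] cF by auto
  let ?eps = "(1 - p) / 2 * real N"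
  have "measure_pmf.prob (gnp n p)
           {G. real (\<Sum>a\<in>A. card (nonnbrs G B a)) < (1 - p) / 2 * (real (card A) * real (card B))}
        = measure_pmf.prob ?P {\<omega>. real (N - card {e \<in> F. \<omega> e}) < ?eps}"
    unfolding gnp_def measure_map_pmf vimage_def mem_Collect_eq count by (simp add: N_def)
  also have "\<dots> \<le> measure_pmf.prob ?P {\<omega>. real (card {e \<in> F. \<omega> e}) \<ge> real N * p + ?eps}"
  proof (rule measure_pmf.finite_measure_mono)
    show "{\<omega>. real (N - card {e \<in> F. \<omega> e}) < ?eps}
       \<subseteq> {\<omega>. real (card {e \<in> F. \<omega> e}) \<ge> real N * p + ?eps}"
      using cle by (auto simp: of_nat_diff field_simps)
  qed simp
  also have "\<dots> = measure_pmf.prob (binomial_pmf N p) {x. real x \<ge> real N * p + ?eps}"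
    by (simp add: bin vimage_def)
  also have "\<dots> \<le> exp (-2 * ?eps\<^sup>2 / real N)"
    using p Npos by (intro binomial_distribution.prob_ge) (auto simp: binomial_distribution_def)
  also have "-2 * ?eps\<^sup>2 / real N = - ((1 - p)\<^sup>2 / 2 * (real (card A) * real (card B)))"
    using Npos by (simp add: N_def power2_eq_square field_simps)
  finally show ?thesis .
qed

text \<open>The binomial expansion of (1 + 1/|V|)^|V|, which is at most e. It lets a union bound run
  over subsets of all sizes at once.\<close>

lemma sum_inverse_power_card_Pow_le:
  assumes "finite V"
  shows "(\<Sum>B\<in>Pow V. (1 / real (card V)) ^ card B) \<le> 3"
proof -
  have "(\<Sum>B\<in>Pow V. (1 / real (card V)) ^ card B) = (1 + 1 / real (card V)) ^ card V"
    using prod_add[OF assms, of "\<lambda>_. 1 / real (card V)" "\<lambda>_. 1"] by (simp add: add.commute)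
  also have "\<dots> \<le> exp (1 / real (card V)) ^ card V"
    by (intro power_mono) auto
  also have "\<dots> \<le> exp 1"
    by (simp flip: exp_of_nat_mult)
  also have "\<dots> \<le> 3" by (rule exp_le)
  finally show ?thesis .
qed

text \<open>Inclusion on the support suffices, so facts such as \<open>verts G = {1..n}\<close> may
  be used.\<close>

lemma prob_mono_set_pmf:
  assumes "\<And>x. x \<in> set_pmf M \<Longrightarrow> x \<in> A \<Longrightarrow> x \<in> B"
  shows "measure_pmf.prob M A \<le> measure_pmf.prob M B"
  using assms by (intro measure_pmf.finite_measure_mono_AE) (auto simp: AE_measure_pmf_iff)

text \<open>The constant 8 turns the Hoeffding bound into n^(-4|B|). This pays n^(-|A|-|B|) for the
  choice of the sets and leaves n^(-2).\<close>

lemma prob_co_bidense: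
  fixes p :: real
  assumes p: "0 < p" "p < 1" and n: "n \<ge> 2"
    and R: "8 / (1 - p)\<^sup>2 * ln (real n) \<le> real R"
  shows "measure_pmf.prob (gnp n p) {G. co_bidense G ((1 - p) / 2) R} \<ge> 1 - 9 / real n ^ 2"
proof -
  define x where "x = 1 / real n"
  define I where "I = {(A, B). A \<subseteq> {1..n} \<and> B \<subseteq> {1..n} \<and> A \<inter> B = {} \<and> card A = R \<and> R \<le> card B}"
  define E where "E = (\<lambda>(A, B). {G :: nat ugraph. real (\<Sum>a\<in>A. card (nonnbrs G B a))
      < (1 - p) / 2 * (real (card A) * real (card B))})"
  have Isub: "I \<subseteq> Pow {1..n} \<times> Pow {1..n}" by (auto simp: I_def)
  then have finI: "finite I" using finite_subset by blast
  have "0 < 8 / (1 - p)\<^sup>2 * ln (real n)" using n p by simp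
  then have Rpos: "R \<ge> 1" using R by linarith
  have x: "0 < x" "x \<le> 1" using n by (auto simp: x_def)
  have bound: "measure_pmf.prob (gnp n p) (E (A, B)) \<le> x ^ 2 * (x ^ card A * x ^ card B)"
    if AB: "(A, B) \<in> I" for A B
  proof -
    have c: "card A = R" "R \<le> card B" using AB by (auto simp: I_def)
    have "measure_pmf.prob (gnp n p) (E (A, B))
        \<le> exp (- ((1 - p)\<^sup>2 / 2 * (real (card A) * real (card B))))"
      unfolding E_def prod.case using AB Rpos
      by (intro prob_few_nonedges_between p) (auto simp: I_def)
    also have "\<dots> \<le> exp (- (real (4 * card B) * ln (real n)))"
    proof -
      have "8 * ln (real n) \<le> (1 - p)\<^sup>2 * real R"
        using R p by (simp add: field_simps)
      then have "8 * ln (real n) * real (card B) \<le> (1 - p)\<^sup>2 * real R * real (card B)"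
        by (intro mult_right_mono) auto
      then show ?thesis using c by (simp add: field_simps)
    qed
    also have "\<dots> = x ^ (4 * card B)"
    proof -
      have "x = exp (- ln (real n))" using n by (simp add: x_def exp_minus field_simps)
      then show ?thesis by (simp flip: exp_of_nat_mult)
    qed
    \<comment> \<open>Here |A| = R is at most |B|, and |B| is at least 1, so 2 + |A| + |B| is at
      most 4|B|.\<close>
    also have "\<dots> \<le> x ^ (2 + (card A + card B))"
      using x c Rpos by (intro power_decreasing) auto
    finally show ?thesis by (simp only: power_add)
  qed
  have "measure_pmf.prob (gnp n p) (\<Union>i\<in>I. E i) \<le> (\<Sum>i\<in>I. measure_pmf.prob (gnp n p) (E i))"
    by (rule measure_pmf.finite_measure_subadditive_finite[OF finI]) simp
  also have "\<dots> \<le> (\<Sum>(A, B)\<in>I. x ^ 2 * (x ^ card A * x ^ card B))"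
    using bound by (intro sum_mono) auto
  \<comment> \<open>Admitting all pairs of subsets makes the sum factorise.\<close>
  also have "\<dots> \<le> (\<Sum>(A, B)\<in>Pow {1..n} \<times> Pow {1..n}. x ^ 2 * (x ^ card A * x ^ card B))"
    using Isub x by (intro sum_mono2) auto
  also have "\<dots> = (\<Sum>A\<in>Pow {1..n}. \<Sum>B\<in>Pow {1..n}. x ^ 2 * (x ^ card A * x ^ card B))"
    by (rule sum.cartesian_product[symmetric])
  also have "\<dots> = x ^ 2 * ((\<Sum>A\<in>Pow {1..n}. x ^ card A) * (\<Sum>B\<in>Pow {1..n}. x ^ card B))"
    by (subst sum_product) (simp only: sum_distrib_left)
  also have "\<dots> \<le> x ^ 2 * (3 * 3)"
    using sum_inverse_power_card_Pow_le[of "{1..n}"] x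
    by (intro mult_left_mono mult_mono sum_nonneg) (auto simp: x_def)
  finally have ub: "measure_pmf.prob (gnp n p) (\<Union>i\<in>I. E i) \<le> 9 / real n ^ 2"
    by (simp add: x_def power_divide)
  have "1 - measure_pmf.prob (gnp n p) (\<Union>i\<in>I. E i) = measure_pmf.prob (gnp n p) (- (\<Union>i\<in>I. E i))"
    using measure_pmf.prob_compl[of "\<Union>i\<in>I. E i" "gnp n p"] by (simp add: Compl_eq_Diff_UNIV)
  also have "\<dots> \<le> measure_pmf.prob (gnp n p) {G. co_bidense G ((1 - p) / 2) R}"
  proof (rule prob_mono_set_pmf)
    fix G assume G: "G \<in> set_pmf (gnp n p)" "G \<in> - (\<Union>i\<in>I. E i)"
    have "verts G = {1..n}" using G(1) by (auto simp: gnp_def)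
    then show "G \<in> {G. co_bidense G ((1 - p) / 2) R}"
      using G(2) by (auto simp: co_bidense_def I_def E_def not_less simp del: of_nat_sum)
  qed
  finally show ?thesis using ub by linarith
qed

section \<open>The explicit bound on the number of edges\<close>

lemma kst_bound_solve:
  fixes m n L M C c D :: real
  assumes "m \<ge> 0" "1 \<le> L" "L \<le> n" "0 < c" "0 < C" "M \<le> C * L" "s \<ge> 1"
    and D: "D = m / (2 * n)"
    and count: "M \<le> D \<Longrightarrow> c * (n * D ^ s) \<le> n ^ s * M"
  shows "m \<le> (2 * C + 2 * (C / c) powr (1 / real s)) * n powr (2 - 1 / real s) * L powr (1 / real s)"
proof -
  define a where "a = 1 / real s"
  have a: "0 < a" "a \<le> 1" using assms(7) by (auto simp: a_def)
  have npos: "n > 0" using assms by linarith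
  define P where "P = n powr (2 - a) * L powr a"
  have P0: "P \<ge> 0" by (simp add: P_def)
  have m: "m = 2 * n * D" using npos by (simp add: D)
  show ?thesis
  proof (cases "M \<le> D")
    case False
    \<comment> \<open>For \<open>D\<close> below \<open>M\<close> the bound is linear in
      \<open>n * L\<close>, which \<open>L \<le> n\<close> brings under the target order.\<close>
    have "L = L powr (1 - a) * L powr a" using assms(2) by (simp flip: powr_add)
    also have "\<dots> \<le> n powr (1 - a) * L powr a"
      using assms a by (intro mult_right_mono powr_mono2) auto
    finally have "n * L \<le> n * (n powr (1 - a) * L powr a)" using npos by simp
    also have "\<dots> = P"
      using npos powr_add[of n 1 "1 - a"] by (simp add: P_def)
    finally have nL: "n * L \<le> P" .
    have "m \<le> 2 * n * (C * L)"
      unfolding m using False assms(6) npos by (intro mult_left_mono) auto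
    also have "\<dots> = 2 * C * (n * L)" by simp
    also have "\<dots> \<le> 2 * C * P" using nL assms(5) by (intro mult_left_mono) auto
    also have "\<dots> \<le> (2 * C + 2 * (C / c) powr a) * P"
      using P0 by (intro mult_right_mono) auto
    finally show ?thesis by (simp add: P_def a_def mult.assoc)
  next
    case True
    have D0: "D \<ge> 0" using assms(1) npos by (simp add: D)
    \<comment> \<open>The count is solved for \<open>D\<close> by taking the \<open>s\<close>-th
      root.\<close>
    have "c * (n * D ^ s) \<le> n ^ s * (C * L)"
      using count[OF True] assms(6) npos
      by (meson mult_left_mono order_trans zero_le_power less_imp_le)
    then have "D ^ s \<le> n ^ s * (1 / n) * (C / c) * L"
      using npos assms(4) by (simp add: field_simps)
    then have "(D ^ s) powr a \<le> (n ^ s * (1 / n) * (C / c) * L) powr a"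
      using D0 a by (intro powr_mono2) auto
    also have "\<dots> = (n ^ s) powr a * (1 / n) powr a * (C / c) powr a * L powr a"
      by (simp only: powr_mult)
    also have "(n ^ s) powr a = n"
      using npos assms(7) by (simp add: a_def powr_powr flip: powr_realpow)
    also have "(1 / n) powr a = n powr (- a)"
      using npos by (simp add: powr_divide powr_minus field_simps)
    also have "(D ^ s) powr a = D"
      using D0 assms(7) by (cases "D = 0") (auto simp: a_def powr_powr simp flip: powr_realpow)
    finally have "m \<le> 2 * n * (n * n powr (- a) * (C / c) powr a * L powr a)"
      unfolding m using npos by (intro mult_left_mono) auto
    also have "\<dots> = 2 * (C / c) powr a * P"
      using npos powr_add[of n 2 "- a"] by (simp add: P_def power2_eq_square)
    also have "\<dots> \<le> (2 * C + 2 * (C / c) powr a) * P"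
      using P0 assms(5) by (intro mult_right_mono) auto
    finally show ?thesis by (simp add: P_def a_def mult.assoc)
  qed
qed

theorem theorem2p1:
  fixes s t :: nat and p :: real
  assumes "s \<ge> 1" and "t \<ge> 1" and "0 < p" and "p < 1"
  shows "\<exists>C'>0. (\<lambda>n. measure_pmf.prob (gnp n p)
           {G. real (ex_ind G (complete_bipartite s t))
                 \<le> C' * real n powr (2 - 1 / real s) * ln (real n) powr (1 / real s)})
         \<longlonglongrightarrow> 1"
proof -
  define k where "k = max s t"
  \<comment> \<open>One half comes from the density in \<open>co_bidense\<close>, the other from
    passing to \<open>co_rich\<close>.\<close>
  define \<delta> where "\<delta> = (1 - p) / 2 / 2"
  define K where "K = 8 / (1 - p)\<^sup>2"
  \<comment> \<open>The 2 is from the threshold \<open>2 * R\<close>, and \<open>K + 1\<close>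
    instead of \<open>K\<close> absorbs the ceiling in \<open>R\<close>.\<close>
  define C where "C = 2 * (K + 1) / \<delta> ^ k"
  define c where "c = (\<delta> ^ k / 2) ^ s"
  define C' where "C' = 2 * C + 2 * (C / c) powr (1 / real s)"
  have \<delta>: "0 < \<delta>" "\<delta> \<le> 1" and K: "K > 0" using assms by (auto simp: \<delta>_def K_def)
  then have C: "C > 0" and c: "c > 0" by (auto simp: C_def c_def)
  have C': "C' > 0" using C by (simp add: C'_def add_pos_nonneg)
  define good where "good n = {G :: nat ugraph. real (ex_ind G (complete_bipartite s t))
      \<le> C' * real n powr (2 - 1 / real s) * ln (real n) powr (1 / real s)}" for n :: nat
  \<comment> \<open>From 3 on, \<open>n\<close> is at least e and hence \<open>ln n\<close> at least
    1.\<close>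
  have lower: "1 - 9 / real n ^ 2 \<le> measure_pmf.prob (gnp n p) (good n)" if n: "n \<ge> 3" for n
  proof -
    define R where "R = nat \<lceil>K * ln (real n)\<rceil>"
    have "exp 1 \<le> real n" using exp_le n by linarith
    then have L: "1 \<le> ln (real n)" using n by (simp add: ln_ge_iff)
    have R: "K * ln (real n) \<le> real R" by (simp add: R_def real_nat_ceiling_ge)
    have "0 < K * ln (real n)" using K L by simp
    then have R1: "R \<ge> 1" using R by linarith
    have "real R \<le> K * ln (real n) + 1"
      using \<open>0 < K * ln (real n)\<close> by (simp add: R_def)
    also have "\<dots> \<le> (K + 1) * ln (real n)" using L by (simp add: algebra_simps)
    finally have "2 * real R / \<delta> ^ k \<le> 2 * ((K + 1) * ln (real n)) / \<delta> ^ k"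
      using \<delta> by (intro divide_right_mono) auto
    then have M: "2 * real R / \<delta> ^ k \<le> C * ln (real n)" by (simp add: C_def algebra_simps)
    have "1 - 9 / real n ^ 2 \<le> measure_pmf.prob (gnp n p) {G. co_bidense G ((1 - p) / 2) R}"
      using n R assms by (intro prob_co_bidense) (auto simp: K_def)
    also have "\<dots> \<le> measure_pmf.prob (gnp n p) (good n)"
    proof (rule prob_mono_set_pmf)
      fix G assume G: "G \<in> set_pmf (gnp n p)" "G \<in> {G. co_bidense G ((1 - p) / 2) R}"
      have V: "verts G = {1..n}" and sG: "simple_graph G"
        using G(1) by (auto simp: gnp_def simple_graph_def)
      have rich: "co_rich G \<delta> (2 * real R)"
        unfolding \<delta>_def using G(2) V R1 assms by (intro co_bidense_imp_co_rich) auto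
      have bound: "real (card (edges H))
          \<le> C' * real n powr (2 - 1 / real s) * ln (real n) powr (1 / real s)"
        if H: "subgraph_of H G" "\<not> has_induced_copy H (complete_bipartite s t)" for H
        unfolding C'_def
      proof (rule kst_bound_solve[OF _ L _ c C M assms(1) refl])
        show "ln (real n) \<le> real n" using n ln_less_self[of "real n"] by linarith
        assume "2 * real R / \<delta> ^ k \<le> real (card (edges H)) / (2 * real n)"
        then show "c * (real n * (real (card (edges H)) / (2 * real n)) ^ s)
            \<le> real n ^ s * (2 * real R / \<delta> ^ k)"
          using co_rich_induced_kst[OF sG rich \<delta> _ H assms(1), of k "real (card (edges H)) / (2 * real n)"]
            R1 V by (simp add: c_def k_def)
      qed simp
      \<comment> \<open>The set is finite and nonempty, so the maximum is attained by some
        \<open>H\<close> to which \<open>bound\<close> applies.\<close>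
      have "ex_ind G (complete_bipartite s t) \<in>
          {card (edges H) | H. subgraph_of H G \<and> \<not> has_induced_copy H (complete_bipartite s t)}"
        unfolding ex_ind_def using ex_ind_finite[OF sG] ex_ind_nonempty[OF sG assms(1,2)]
        by (intro Max_in) blast+
      then show "G \<in> good n" using bound by (auto simp: good_def)
    qed
    finally show ?thesis .
  qed
  have "(\<lambda>n. measure_pmf.prob (gnp n p) (good n)) \<longlonglongrightarrow> 1"
  proof (rule tendsto_sandwich)
    show "(\<lambda>n. 1 - 9 / real n ^ 2) \<longlonglongrightarrow> 1"
      by real_asymp
    show "\<forall>\<^sub>F n in sequentially. 1 - 9 / real n ^ 2 \<le> measure_pmf.prob (gnp n p) (good n)"
      using lower eventually_ge_at_top[of 3] by (rule eventually_mono[rotated])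
  qed auto
  then show ?thesis using C' unfolding good_def by blast
qed

end
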